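(* Let $b>1$ be an integer and let $v_2=v_3=\dots=v_b=1$. Then $v_1^*(v_2,\dots,v_b)=3^{b-1}+1$, and the corresponding integer is $$n=\frac{2^{b-1}2^{3^{b-1}+1}}{3^b}-\sum_{i=1}^{b}\frac{2^{b-i}}{3^{b-i+1}}.$$
   Context: A tuple $(b,u_0>u_1>\dots>u_b=0)$ of integers with $b\ge 1$ and $u_0\ge b\frac{\log 3}{\log 2}$ is called admissible if $n=\frac{2^{u_0}}{3^b}-\sum_{i=1}^{b}\frac{2^{u_i}}{3^{b-i+1}}\in\mathbb{N}$; this $n$ is the integer corresponding to the tuple. In the alternative notation, $(b,v_1,\dots,v_b)$ with positive integers $v_i$ stands for the tuple $(b,u_0>\dots>u_b=0)$ with $v_i=u_{i-1}-u_i$, i.e. $u_i=\sum_{l=i+1}^b v_l$. For integers $v_2,\dots,v_b$ with $1\le v_i\le 2\cdot 3^{b-i}$, $v_1^*(v_2,\dots,v_b)$ denotes the unique even integer $v_1$ with $4\le v_1\le 2\cdot 3^{b-1}+2$ such that $(b,v_1,v_2,\dots,v_b)$ is admissible. *)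

theory Defs
  imports Complex_Main
begin

(* A tuple (b, u_0 > ... > u_b = 0) is given by b and a function u, of which only the values
   at 0, ..., b matter.  Its entries are natural numbers, which loses nothing, since an integer
   sequence decreasing to 0 is nonnegative. *)

definition tuple_value :: "nat \<Rightarrow> (nat \<Rightarrow> nat) \<Rightarrow> real" where
  "tuple_value b u = 2 ^ u 0 / 3 ^ b - (\<Sum>i = 1..b. 2 ^ u i / 3 ^ (b - i + 1))"

(* It does not matter whether 0 counts as a natural number here: since u_b = 0 < u_0, the number
   3^b * tuple_value b u is odd, so the value of a tuple is never 0. *)

definition admissible :: "nat \<Rightarrow> (nat \<Rightarrow> nat) \<Rightarrow> bool" where
  "admissible b u \<longleftrightarrow>
     b \<ge> 1 \<and> (\<forall>i<b. u (i + 1) < u i) \<and> u b = 0 \<and>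
     real (u 0) \<ge> real b * (ln 3 / ln 2) \<and> tuple_value b u \<in> \<nat>"

(* Meaningful only for admissible tuples. *)

definition corresponding_integer :: "nat \<Rightarrow> (nat \<Rightarrow> nat) \<Rightarrow> nat" where
  "corresponding_integer b u = (THE n. real n = tuple_value b u)"

(* Passage from the notation (b, v_1, ..., v_b), where only the values of v at 1, ..., b matter. *)

definition u_of_v :: "nat \<Rightarrow> (nat \<Rightarrow> nat) \<Rightarrow> nat \<Rightarrow> nat" where
  "u_of_v b v i = (\<Sum>l = i + 1..b. v l)"

(* The number v_1^*(v_2, ..., v_b), meant for 1 \<le> v i \<le> 2 * 3 ^ (b - i) with i = 2, ..., b.
   The value v 1 is overwritten by the candidate k and hence irrelevant. *)

definition v1_star :: "nat \<Rightarrow> (nat \<Rightarrow> nat) \<Rightarrow> nat" where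
  "v1_star b v =
     (THE k. even k \<and> 4 \<le> k \<and> k \<le> 2 * 3 ^ (b - 1) + 2 \<and> admissible b (u_of_v b (v(1 := k))))"

end

theory Submission
  imports Defs "HOL-Number_Theory.Cong"
begin

text \<open>
  Summing the geometric series, the tuple \<open>(b, k, 1, \<dots>, 1)\<close> has the value
  \<open>2^b (2^(k - 1) + 1) / 3^b - 1\<close>, so for even \<open>k\<close> it is admissible (given the size condition) iff
  \<open>3^b\<close> divides \<open>2^(k - 1) + 1\<close>. By lifting the exponent this means that \<open>k - 1\<close> is an odd multiple
  of \<open>3^(b - 1)\<close>, and the only such multiple in the allowed range is \<open>3^(b - 1)\<close> itself.
\<close>

text \<open>Since 2^6 = 64 is 1 modulo 9, only the residue of \<open>m\<close> modulo 6
  matters.\<close>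

lemma three_dvd_if_nine_dvd_power_two_plus_one:
  fixes m :: nat
  assumes "9 dvd (2 ^ m + 1 :: int)"
  shows "3 dvd m"
proof -
  define r where "r = m mod 6"
  have "(2::int) ^ m = (2 ^ 6) ^ (m div 6) * 2 ^ r"
    unfolding r_def power_mult [symmetric] power_add [symmetric] by simp
  moreover have "[(2 ^ 6) ^ (m div 6) * 2 ^ r = 1 ^ (m div 6) * 2 ^ r] (mod (9::int))"
    by (intro cong_mult cong_pow) (simp_all add: cong_def)
  ultimately have "[2 ^ m + 1 = 2 ^ r + 1] (mod (9::int))"
    by (intro cong_add) simp_all
  then have dvd: "9 dvd (2 ^ r + 1 :: int)"
    using assms by (simp add: cong_dvd_iff)
  have "r < 6"
    by (simp add: r_def)
  then have "r = 0 \<or> r = 1 \<or> r = 2 \<or> r = 3 \<or> r = 4 \<or> r = 5"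
    by auto
  \<comment> \<open>The six values of \<open>2 ^ r + 1\<close> are 2, 3, 5, 9, 17, 33, and only 9 is
    a multiple of 9.\<close>
  then have "r = 3"
    using dvd by auto
  then show ?thesis
    unfolding r_def by presburger
qed

text \<open>Each factor 3 of \<open>m\<close> adds exactly one factor 3 to \<open>2 ^ m + 1\<close>:
  for m = 3 l and x = 2^l, the sum x^3 + 1 is (x + 1)(x^2 - x + 1), and 3 divides the second factor
  exactly once. If 3 does not divide \<open>m\<close>, both sides fail in the induction step, the
  left one already modulo 9.\<close>

lemma power_three_dvd_power_two_plus_one_iff:
  fixes m n :: nat
  assumes "odd m"
  shows "3 ^ Suc n dvd (2 ^ m + 1 :: int) \<longleftrightarrow> 3 ^ n dvd m"
  using assms
proof (induction n arbitrary: m)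
  case 0
  have "[(2::int) ^ m = (-1) ^ m] (mod 3)"
    by (intro cong_pow) (simp add: cong_def)
  then show ?case
    using 0 by (simp add: cong_iff_dvd_diff)
next
  case (Suc n)
  show ?case
  proof (cases "3 dvd m")
    case False
    have "\<not> 3 ^ Suc (Suc n) dvd (2 ^ m + 1 :: int)"
    proof
      assume "3 ^ Suc (Suc n) dvd (2 ^ m + 1 :: int)"
      then have "9 dvd (2 ^ m + 1 :: int)"
        by (auto intro: dvd_trans [of _ "9 * 3 ^ n"])
      then show False
        using False three_dvd_if_nine_dvd_power_two_plus_one by blast
    qed
    moreover have "\<not> 3 ^ Suc n dvd m"
      using False by (auto dest: dvd_mult_left)
    ultimately show ?thesis
      by blast
  next
    case True
    then obtain l where l: "m = 3 * l" ..
    with Suc.prems have "odd l"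
      by simp
    define x :: int where "x = 2 ^ l"
    have "[x = (-1) ^ l] (mod 3)"
      unfolding x_def by (intro cong_pow) (simp add: cong_def)
    then have "3 dvd x + 1"
      using \<open>odd l\<close> by (simp add: cong_iff_dvd_diff)
    \<comment> \<open>This substitution turns x^2 - x + 1 into 3 (3 (y^2 - y) + 1), which exposes
      its single factor 3.\<close>
    then obtain y where y: "x = 3 * y - 1"
      by (metis add_diff_cancel_right' dvdE)
    have "2 ^ m + 1 = x ^ 3 + 1"
      by (simp add: l x_def power_mult [symmetric] mult.commute)
    also have "\<dots> = 3 * ((x + 1) * (3 * (y ^ 2 - y) + 1))"
      unfolding y by (simp add: power2_eq_square power3_eq_cube algebra_simps)
    finally have "3 ^ Suc (Suc n) dvd (2 ^ m + 1 :: int)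
        \<longleftrightarrow> 3 ^ Suc n dvd (x + 1) * (3 * (y ^ 2 - y) + 1)"
      by (simp only: power_Suc [of 3 "Suc n"] dvd_mult_cancel_left) simp
    also have "\<dots> \<longleftrightarrow> 3 ^ Suc n dvd x + 1"
    proof (rule coprime_dvd_mult_left_iff)
      have "coprime 3 (3 * (y ^ 2 - y) + 1)"
        by (metis coprime_1_right coprime_iff_gcd_eq_1 gcd_add_mult add.commute mult.commute)
      then show "coprime (3 ^ Suc n) (3 * (y ^ 2 - y) + 1)"
        by simp
    qed
    also have "\<dots> \<longleftrightarrow> 3 ^ n dvd l"
      using Suc.IH [OF \<open>odd l\<close>] by (simp only: x_def)
    also have "\<dots> \<longleftrightarrow> 3 ^ Suc n dvd m"
      by (simp add: l)
    finally show ?thesis .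
  qed
qed

text \<open>Reversing the order of summation gives a geometric series with first term 1/3 and ratio
  2/3.\<close>

lemma sum_two_thirds_powers:
  "(\<Sum>i = 1..b. 2 ^ (b - i) / 3 ^ (b - i + 1)) = 1 - (2 / 3 :: real) ^ b"
proof -
  have "(\<Sum>i = 1..b. 2 ^ (b - i) / 3 ^ (b - i + 1)) = (\<Sum>j<b. 2 ^ j / 3 ^ (j + 1) :: real)"
    by (rule sum.reindex_bij_witness [where i = "\<lambda>j. b - j" and j = "\<lambda>i. b - i"]) auto
  also have "\<dots> = 1 - (2 / 3) ^ b"
    by (induction b) (simp_all add: field_simps)
  finally show ?thesis .
qed

context
  fixes b :: nat and v :: "nat \<Rightarrow> nat"
  assumes b: "b \<ge> 1" and v: "\<forall>i\<in>{2..b}. v i = 1"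
begin

lemma u_of_v_ones:
  assumes "i \<ge> 1"
  shows "u_of_v b (v(1 := k)) i = b - i"
proof -
  have "u_of_v b (v(1 := k)) i = (\<Sum>l = i + 1..b. 1)"
    unfolding u_of_v_def by (rule sum.cong) (use assms v in auto)
  then show ?thesis
    by simp
qed

lemma u_of_v_ones_0: "u_of_v b (v(1 := k)) 0 = k + (b - 1)"
proof -
  have "u_of_v b (v(1 := k)) 0 = k + u_of_v b (v(1 := k)) 1"
    unfolding u_of_v_def using b by (simp add: sum.atLeast_Suc_atMost)
  then show ?thesis
    by (simp only: u_of_v_ones)
qed

text \<open>The sum stays unevaluated because the final formula for the corresponding integer
  contains it in this form.\<close>

lemma tuple_value_ones:
  "tuple_value b (u_of_v b (v(1 := k))) =
     2 ^ (k + (b - 1)) / 3 ^ b - (\<Sum>i = 1..b. 2 ^ (b - i) / 3 ^ (b - i + 1))"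
  unfolding tuple_value_def by (simp add: u_of_v_ones [simplified] u_of_v_ones_0 [simplified])

text \<open>The sum contributes (2/3)^b - 1, and \<open>2 ^ b\<close> factors out of both powers of
  2 because k + (b - 1) = b + (k - 1).\<close>

lemma tuple_value_ones_closed:
  assumes "k \<ge> 1"
  shows "tuple_value b (u_of_v b (v(1 := k))) = 2 ^ b * (2 ^ (k - 1) + 1) / 3 ^ b - 1"
proof -
  have "k + (b - 1) = b + (k - 1)"
    using assms b by simp
  then show ?thesis
    unfolding tuple_value_ones sum_two_thirds_powers
    by (simp only: power_add power_divide) (simp add: field_simps)
qed

lemma tuple_value_ones_in_Nats_iff:
  assumes "k \<ge> 1"
  shows "tuple_value b (u_of_v b (v(1 := k))) \<in> \<nat> \<longleftrightarrow> 3 ^ b dvd (2 ^ (k - 1) + 1 :: int)"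
proof -
  define a :: int where "a = 2 ^ (k - 1) + 1"
  have val: "tuple_value b (u_of_v b (v(1 := k))) = of_int (2 ^ b * a) / of_int (3 ^ b) - 1"
    using tuple_value_ones_closed [OF assms] by (simp add: a_def)
  have "tuple_value b (u_of_v b (v(1 := k))) \<in> \<nat> \<longleftrightarrow> 3 ^ b dvd 2 ^ b * a"
  proof
    assume "tuple_value b (u_of_v b (v(1 := k))) \<in> \<nat>"
    then obtain n where "tuple_value b (u_of_v b (v(1 := k))) = real n"
      by (auto simp: Nats_def)
    with val have "of_int (2 ^ b * a) = (of_int (3 ^ b * (int n + 1)) :: real)"
      by (simp add: field_simps)
    then show "3 ^ b dvd 2 ^ b * a"
      unfolding of_int_eq_iff by simp
  next
    assume "3 ^ b dvd 2 ^ b * a"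
    then obtain c where c: "2 ^ b * a = 3 ^ b * c" ..
    \<comment> \<open>Positivity makes the quotient \<open>c\<close> at least 1, so that the value c
      - 1 is a natural number and not just an integer.\<close>
    have "0 < 2 ^ b * a"
      by (simp add: a_def add_pos_pos)
    then have "c > 0"
      unfolding c by (simp add: zero_less_mult_iff)
    then have "tuple_value b (u_of_v b (v(1 := k))) = real (nat (c - 1))"
      unfolding val c by simp
    then show "tuple_value b (u_of_v b (v(1 := k))) \<in> \<nat>"
      by (simp only: of_nat_in_Nats)
  qed
  also have "\<dots> \<longleftrightarrow> 3 ^ b dvd a"
    by (rule coprime_dvd_mult_right_iff) simp
  finally show ?thesis
    by (simp only: a_def)
qed

text \<open>Evenness of \<open>k\<close> makes the exponent k - 1 odd, as lifting the exponent
  requires. The size condition follows from the divisibility.\<close>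

lemma admissible_ones_iff:
  assumes "even k" "k \<ge> 1"
  shows "admissible b (u_of_v b (v(1 := k))) \<longleftrightarrow> 3 ^ (b - 1) dvd k - 1"
proof -
  have "odd (k - 1)"
    using assms by simp
  then have iff: "tuple_value b (u_of_v b (v(1 := k))) \<in> \<nat> \<longleftrightarrow> 3 ^ (b - 1) dvd k - 1"
    using power_three_dvd_power_two_plus_one_iff [of "k - 1" "b - 1"]
      tuple_value_ones_in_Nats_iff [OF assms(2)] b by simp
  have dec: "u_of_v b (v(1 := k)) (i + 1) < u_of_v b (v(1 := k)) i" if "i < b" for i
    using that assms(2) by (cases "i = 0") (simp_all add: u_of_v_ones [simplified] u_of_v_ones_0 [simplified])
  have size: "real b * (ln 3 / ln 2) \<le> real (u_of_v b (v(1 := k)) 0)" if "3 ^ (b - 1) dvd k - 1"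
  proof -
    \<comment> \<open>A positive multiple of 3^(b - 1) is at least 3^(b - 1), hence at least b. So
      u_0 = k + (b - 1) is at least 2 b, which suffices because log 3 / log 2 \<le> log 4 / log 2 =
      2.\<close>
    have "k - 1 > 0"
      using \<open>odd (k - 1)\<close> by (rule odd_pos)
    with that have "3 ^ (b - 1) \<le> k - 1"
      by (rule dvd_imp_le)
    moreover have "b - 1 < 3 ^ (b - 1)"
      by (rule power_gt_expt) simp
    ultimately have "2 * b \<le> k + (b - 1)"
      by linarith
    moreover have "ln 3 / ln 2 \<le> (2::real)"
    proof -
      have "ln 3 \<le> ln ((2::real) ^ 2)"
        by (subst ln_le_cancel_iff) simp_all
      also have "\<dots> = 2 * ln 2"
        by (subst ln_realpow) simp_all
      finally show ?thesis
        by (simp add: divide_le_eq)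
    qed
    then have "real b * (ln 3 / ln 2) \<le> real b * 2"
      by (rule mult_left_mono) simp
    ultimately show ?thesis
      unfolding u_of_v_ones_0 by linarith
  qed
  show ?thesis
    unfolding admissible_def using b iff dec size by (auto simp: u_of_v_ones [simplified])
qed

end

text \<open>Admissibility provides a witness for the definite description, and injectivity of
  \<open>real\<close> makes it unique.\<close>

lemma corresponding_integer_eq:
  assumes "admissible b u"
  shows "real (corresponding_integer b u) = tuple_value b u"
proof -
  obtain n where n: "tuple_value b u = real n"
    using assms by (auto simp: admissible_def Nats_def)
  then have "corresponding_integer b u = n"
    by (simp add: corresponding_integer_def)
  with n show ?thesis
    by simp
qed

theorem theorem5:
  fixes b :: nat and v :: "nat \<Rightarrow> nat"
  assumes "b > 1"
    and "\<forall>i\<in>{2..b}. v i = 1"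
  shows "v1_star b v = 3 ^ (b - 1) + 1 \<and>
    real (corresponding_integer b (u_of_v b (v(1 := v1_star b v)))) =
      2 ^ (b - 1) * 2 ^ (3 ^ (b - 1) + 1) / 3 ^ b - (\<Sum>i = 1..b. 2 ^ (b - i) / 3 ^ (b - i + 1))"
proof -
  define K :: nat where "K = 3 ^ (b - 1) + 1"
  have b: "b \<ge> 1"
    using assms(1) by simp
  \<comment> \<open>This is where b > 1 enters: it gives the lower bound 4 for \<open>K\<close>, and
    it excludes the multiplier 3 in the uniqueness argument.\<close>
  have "(3::nat) ^ 1 \<le> 3 ^ (b - 1)"
    using assms(1) by (intro power_increasing) auto
  then have three: "(3::nat) \<le> 3 ^ (b - 1)"
    by simp
  have K: "even K" "4 \<le> K" "K \<le> 2 * 3 ^ (b - 1) + 2"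
    using three by (simp_all add: K_def)
  have adm: "admissible b (u_of_v b (v(1 := K)))"
    using admissible_ones_iff [OF b assms(2) K(1)] K(2) by (simp add: K_def)
  have unique: "k = K"
    if k: "even k" "4 \<le> k" "k \<le> 2 * 3 ^ (b - 1) + 2" "admissible b (u_of_v b (v(1 := k)))" for k
  proof -
    have "3 ^ (b - 1) dvd k - 1"
      using admissible_ones_iff [OF b assms(2) k(1)] k(2,4) by simp
    then obtain m where m: "k - 1 = 3 ^ (b - 1) * m" ..
    have "odd (k - 1)"
      using k(1,2) by simp
    then have "odd m"
      unfolding m by simp
    have "m < 3"
    proof (rule ccontr)
      \<comment> \<open>Otherwise 3 * 3^(b - 1) \<le> k - 1 \<le> 2 * 3^(b - 1) + 1, which forces
        3^(b - 1) \<le> 1.\<close>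
      assume "\<not> m < 3"
      then have "3 ^ (b - 1) * 3 \<le> k - 1"
        unfolding m by (intro mult_le_mono2) simp
      then show False
        using k(3) three by linarith
    qed
    with \<open>odd m\<close> have "m = 1"
      by presburger
    then show "k = K"
      using m k(2) by (simp add: K_def)
  qed
  have star: "v1_star b v = K"
    unfolding v1_star_def
    by (rule the_equality) (use K adm unique in blast)+
  have "real (corresponding_integer b (u_of_v b (v(1 := K)))) =
      2 ^ (K + (b - 1)) / 3 ^ b - (\<Sum>i = 1..b. 2 ^ (b - i) / 3 ^ (b - i + 1))"
    using corresponding_integer_eq [OF adm] tuple_value_ones [OF b assms(2)] by simp
  also have "(2::real) ^ (K + (b - 1)) = 2 ^ (b - 1) * 2 ^ (3 ^ (b - 1) + 1)"
    by (simp only: K_def power_add mult.commute)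
  finally show ?thesis
    unfolding star by (simp only: K_def simp_thms)
qed

end
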